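(* Let $X$ be a uniformly convex and uniformly smooth Banach space with dual $X^*$ and let $C$ be a nonempty, closed and convex set in $X$. Then: (a) For any $u\in X$, $$\mathcal{F}_C(Ju)=\{y\in C:\ y=P_C(u+y)\}=\{y\in C:\ y=\pi_C(Ju+Jy)\}.$$ (b) For any $\psi\in X^*$, $$\mathcal{F}_C(\psi)=\{y\in C:\ y=P_C(J^*\psi+y)\}=\{y\in C:\ y=\pi_C(\psi+Jy)\}.$$
   Context: Banach spaces are real; $\langle\cdot,\cdot\rangle$ is the duality pairing between $X^*$ and $X$. For $\psi\in X^*$, the face of $\psi$ on $C$ is $\mathcal{F}_C(\psi)=\{y\in C:\langle\psi,y\rangle=\sup_{x\in C}\langle\psi,x\rangle\}$. The normalized duality mapping $J:X\to X^*$ is the single-valued bijection determined by $\langle Jx,x\rangle=\|Jx\|_{X^*}^2=\|x\|_X^2$, and $J^*:X^*\to X$ is its inverse (the normalized duality mapping of $X^*$). The metric projection $P_C:X\to C$ is the map with $\|x-P_Cx\|\le\|x-z\|$ for all $z\in C$. The generalized projection $\pi_C:X^*\to C$ sends $\psi$ to the unique minimizer over $y\in C$ of $V(\psi,y)=\|\psi\|_{X^*}^2-2\langle\psi,y\rangle+\|y\|_X^2$. *)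

theory Defs
  imports "HOL-Analysis.Analysis"
begin

text \<open>
  A real Banach space \<open>X\<close> is a type of class \<open>banach\<close>; its dual is the type of bounded linear
  functionals \<open>'a \<Rightarrow>\<^sub>L real\<close> with the operator norm, the pairing being \<open>blinfun_apply\<close>.
\<close>

definition uniformly_convex_space :: "'a::real_normed_vector itself \<Rightarrow> bool" where
  "uniformly_convex_space _ \<longleftrightarrow>
     (\<forall>\<epsilon>>0. \<exists>\<delta>>0. \<forall>x y :: 'a. norm x = 1 \<longrightarrow> norm y = 1 \<longrightarrow> norm (x - y) \<ge> \<epsilon> \<longrightarrow>
        norm ((x + y) /\<^sub>R 2) \<le> 1 - \<delta>)"

text \<open>
  Equivalently, the modulus of smoothness
  \<open>\<rho> t = sup {(\<parallel>x + y\<parallel> + \<parallel>x - y\<parallel>) / 2 - 1 | \<parallel>x\<parallel> = 1, \<parallel>y\<parallel> = t}\<close> satisfies \<open>\<rho> t / t \<rightarrow> 0\<close> as \<open>t \<rightarrow> 0+\<close>.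
\<close>
definition uniformly_smooth_space :: "'a::real_normed_vector itself \<Rightarrow> bool" where
  "uniformly_smooth_space _ \<longleftrightarrow>
     (\<forall>\<epsilon>>0. \<exists>\<delta>>0. \<forall>x y :: 'a. norm x = 1 \<longrightarrow> norm y \<le> \<delta> \<longrightarrow>
        (norm (x + y) + norm (x - y)) / 2 - 1 \<le> \<epsilon> * norm y)"

text \<open>
  The supremum is taken in the extended reals: if \<open>\<psi>\<close> is unbounded above on \<open>C\<close>, it is \<open>\<infinity>\<close> and the
  face is empty, whereas the supremum of an unbounded set in \<open>real\<close> is an unspecified number.
\<close>
definition face :: "'a::real_normed_vector set \<Rightarrow> ('a \<Rightarrow>\<^sub>L real) \<Rightarrow> 'a set" where
  "face C \<psi> = {y \<in> C. ereal (blinfun_apply \<psi> y) = (SUP x\<in>C. ereal (blinfun_apply \<psi> x))}"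

text \<open>
  In this definition and in those below, the object described exists uniquely when the space is
  uniformly convex and uniformly smooth and, for the projections, \<open>C\<close> is nonempty, closed and
  convex; otherwise the value is unspecified.
\<close>
definition duality_map :: "'a::real_normed_vector \<Rightarrow> ('a \<Rightarrow>\<^sub>L real)" where
  "duality_map x = (THE f. blinfun_apply f x = (norm f)\<^sup>2 \<and> (norm f)\<^sup>2 = (norm x)\<^sup>2)"

definition dual_duality_map :: "('a::real_normed_vector \<Rightarrow>\<^sub>L real) \<Rightarrow> 'a" where
  "dual_duality_map = inv duality_map"

definition metric_projection :: "'a::real_normed_vector set \<Rightarrow> 'a \<Rightarrow> 'a" where
  "metric_projection C x = (THE y. y \<in> C \<and> (\<forall>z\<in>C. norm (x - y) \<le> norm (x - z)))"

definition V_functional :: "('a::real_normed_vector \<Rightarrow>\<^sub>L real) \<Rightarrow> 'a \<Rightarrow> real" where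
  "V_functional \<psi> y = (norm \<psi>)\<^sup>2 - 2 * blinfun_apply \<psi> y + (norm y)\<^sup>2"

definition generalized_projection :: "'a::real_normed_vector set \<Rightarrow> ('a \<Rightarrow>\<^sub>L real) \<Rightarrow> 'a" where
  "generalized_projection C \<psi> =
     (THE y. y \<in> C \<and> (\<forall>z\<in>C. V_functional \<psi> y \<le> V_functional \<psi> z))"

end

theory Submission
  imports Defs
begin

text \<open>
  Everything reduces to minimising \<open>z \<mapsto> \<parallel>z\<parallel>\<^sup>2 - 2 \<langle>\<psi>, z\<rangle>\<close> over a closed convex set. Uniform convexity
  makes minimising sequences Cauchy, so the minimiser exists and is unique. Uniform smoothness
  makes \<open>\<parallel>\<cdot>\<parallel>\<^sup>2 / 2\<close> Gateaux differentiable; its derivative is \<open>J\<close>, which gives \<open>J\<close> without the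
  Hahn-Banach theorem. Hence \<open>y\<close> is the minimiser iff \<open>\<langle>J y - \<psi>, z - y\<rangle> \<ge> 0\<close> on the set. For
  \<open>\<psi> + J y\<close> on \<open>C\<close>, and for \<open>\<psi> = 0\<close> at the point \<open>u\<close> of \<open>u + y - C\<close>, this is the inequality
  that defines the face; on the whole space it says that \<open>J\<close> is surjective.
\<close>

section \<open>Faces as real inequalities\<close>

text \<open>A supremum equal to the value at a point of \<open>C\<close> is attained there and hence
  finite, so the extended reals drop out.\<close>

lemma face_iff:
  "y \<in> face C \<psi> \<longleftrightarrow> y \<in> C \<and> (\<forall>x\<in>C. blinfun_apply \<psi> x \<le> blinfun_apply \<psi> y)"
proof -
  have "ereal (blinfun_apply \<psi> y) = (SUP x\<in>C. ereal (blinfun_apply \<psi> x)) \<longleftrightarrow>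
      (\<forall>x\<in>C. blinfun_apply \<psi> x \<le> blinfun_apply \<psi> y)" if "y \<in> C"
  proof
    assume eq: "ereal (blinfun_apply \<psi> y) = (SUP x\<in>C. ereal (blinfun_apply \<psi> x))"
    show "\<forall>x\<in>C. blinfun_apply \<psi> x \<le> blinfun_apply \<psi> y"
    proof
      fix x assume "x \<in> C"
      then have "ereal (blinfun_apply \<psi> x) \<le> (SUP x\<in>C. ereal (blinfun_apply \<psi> x))"
        by (rule SUP_upper)
      then show "blinfun_apply \<psi> x \<le> blinfun_apply \<psi> y"
        unfolding eq[symmetric] by simp
    qed
  next
    assume le: "\<forall>x\<in>C. blinfun_apply \<psi> x \<le> blinfun_apply \<psi> y"
    show "ereal (blinfun_apply \<psi> y) = (SUP x\<in>C. ereal (blinfun_apply \<psi> x))"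
      using le that by (intro antisym SUP_upper SUP_least) auto
  qed
  then show ?thesis
    unfolding face_def by blast
qed

section \<open>Uniform convexity and existence of minimisers\<close>

text \<open>Uniform convexity concerns unit vectors; this transfers its gain to squared norms on a
  ball. If the norms differ by at least \<open>\<eta>\<close>, strict convexity of the real square
  gives the gain. Otherwise the normalised vectors stay apart and uniform convexity gives
  it.\<close>

lemma uniformly_convex_midpoint_square:
  assumes "uniformly_convex_space TYPE('a::real_normed_vector)" and "0 < \<epsilon>"
  obtains \<delta> where "0 < \<delta>"
    and "\<And>x y::'a. norm x \<le> R \<Longrightarrow> norm y \<le> R \<Longrightarrow> \<epsilon> \<le> norm (x - y) \<Longrightarrow>
      (norm ((x + y) /\<^sub>R 2))\<^sup>2 \<le> ((norm x)\<^sup>2 + (norm y)\<^sup>2) / 2 - \<delta>"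
proof -
  \<comment> \<open>\<open>R\<close> is arbitrary, whereas \<open>S\<close> is positive and may be
    divided by.\<close>
  define S where "S = max R 1"
  have S: "0 < S" "R \<le> S"
    by (auto simp: S_def)
  then have "0 < \<epsilon> / (2 * S)"
    using assms by simp
  then obtain \<delta>0 where \<delta>0: "0 < \<delta>0"
    and uc: "\<And>x y::'a. norm x = 1 \<Longrightarrow> norm y = 1 \<Longrightarrow> \<epsilon> / (2 * S) \<le> norm (x - y) \<Longrightarrow>
      norm ((x + y) /\<^sub>R 2) \<le> 1 - \<delta>0"
    using assms(1) unfolding uniformly_convex_space_def by blast
  \<comment> \<open>The bound \<open>\<epsilon> / 4\<close> keeps the shorter vector away from 0 and
    the unit vectors apart; \<open>\<epsilon> * \<delta>0 / 4\<close> keeps \<open>\<eta>\<close>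
    below the convexity gain \<open>b * \<delta>0\<close>.\<close>
  define \<eta> where "\<eta> = min (\<epsilon> / 4) (\<epsilon> * \<delta>0 / 4)"
  have \<eta>: "0 < \<eta>" "\<eta> \<le> \<epsilon> / 4" "\<eta> \<le> \<epsilon> * \<delta>0 / 4"
    using \<delta>0 assms(2) by (auto simp: \<eta>_def)
  \<comment> \<open>One bound per case: the gains are \<open>(a - b)\<^sup>2 / 4\<close> and
    \<open>\<eta> * b / 2\<close>.\<close>
  define \<delta> where "\<delta> = min (\<eta>\<^sup>2 / 4) (\<eta> * \<epsilon> / 8)"
  have \<delta>: "0 < \<delta>" "\<delta> \<le> \<eta>\<^sup>2 / 4" "\<delta> \<le> \<eta> * \<epsilon> / 8"
    using \<eta> assms(2) by (auto simp: \<delta>_def)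
  have ordered: "(norm ((x + y) /\<^sub>R 2))\<^sup>2 \<le> ((norm x)\<^sup>2 + (norm y)\<^sup>2) / 2 - \<delta>"
    if xy: "norm x \<le> R" "norm y \<le> norm x" "\<epsilon> \<le> norm (x - y)" for x y :: 'a
  proof -
    define a b where "a = norm x" and "b = norm y"
    define m where "m = norm ((x + y) /\<^sub>R 2)"
    have m0: "0 \<le> m"
      by (simp add: m_def)
    have m: "m \<le> (a + b) / 2"
      using norm_triangle_ineq[of x y] by (simp add: m_def a_def b_def)
    have ab: "b \<le> a" "0 \<le> b" "a \<le> S" "\<epsilon> \<le> a + b"
      using xy S norm_triangle_ineq4[of x y] by (auto simp: a_def b_def)
    have "m\<^sup>2 \<le> (a\<^sup>2 + b\<^sup>2) / 2 - \<delta>"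
    proof (cases "\<eta> \<le> a - b")
      case True
      have "m\<^sup>2 \<le> ((a + b) / 2)\<^sup>2"
        using m m0 by (rule power_mono)
      also have "\<dots> = (a\<^sup>2 + b\<^sup>2) / 2 - (a - b)\<^sup>2 / 4"
        by (simp add: power2_eq_square field_simps)
      also have "\<dots> \<le> (a\<^sup>2 + b\<^sup>2) / 2 - \<delta>"
        using power_mono[OF True, of 2] \<eta>(1) \<delta>(2) by simp
      finally show ?thesis .
    next
      case False
      have b: "\<epsilon> / 4 \<le> b"
        using False ab \<eta> by linarith
      have pos: "0 < b" "0 < a"
        using b assms(2) ab by linarith+
      define x0 y0 where "x0 = x /\<^sub>R a" and "y0 = y /\<^sub>R b"
      have n: "norm x0 = 1" "norm y0 = 1" and x: "x = a *\<^sub>R x0" and y: "y = b *\<^sub>R y0"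
        using pos by (auto simp: x0_def y0_def a_def b_def)
      \<comment> \<open>Splits off the radial part, of length \<open>a - b < \<eta>\<close>, so that
        the unit vectors must carry most of the distance.\<close>
      have "x - y = b *\<^sub>R (x0 - y0) + (a - b) *\<^sub>R x0"
        by (simp add: x y algebra_simps)
      then have "norm (x - y) \<le> b * norm (x0 - y0) + (a - b)"
        using norm_triangle_ineq[of "b *\<^sub>R (x0 - y0)" "(a - b) *\<^sub>R x0"] n ab by simp
      then have "\<epsilon> / 2 \<le> b * norm (x0 - y0)"
        using xy(3) False \<eta> by linarith
      also have "\<dots> \<le> S * norm (x0 - y0)"
        using ab by (intro mult_right_mono) auto
      finally have "\<epsilon> / (2 * S) \<le> norm (x0 - y0)"
        using S by (simp add: field_simps)
      define c where "c = (x0 + y0) /\<^sub>R 2"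
      have half: "norm c \<le> 1 - \<delta>0"
        unfolding c_def by (rule uc[OF n \<open>\<epsilon> / (2 * S) \<le> norm (x0 - y0)\<close>])
      have "x + y = (2 * b) *\<^sub>R c + (a - b) *\<^sub>R x0"
        by (simp add: c_def x y scaleR_right_distrib scaleR_left_diff_distrib)
      then have "norm (x + y) \<le> 2 * b * norm c + (a - b)"
        using norm_triangle_ineq[of "(2 * b) *\<^sub>R c" "(a - b) *\<^sub>R x0"] n ab by simp
      moreover have "m = norm (x + y) / 2"
        by (simp add: m_def)
      ultimately have "m \<le> b * norm c + (a - b) / 2"
        by argo
      also have "\<dots> \<le> b * (1 - \<delta>0) + \<eta> / 2"
        using mult_left_mono[OF half ab(2)] False by argo
      also have "\<dots> \<le> b - \<eta> / 2"
        using mult_right_mono[OF b less_imp_le[OF \<delta>0]] \<eta>(3) by argo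
      finally have m': "m \<le> b - \<eta> / 2" .
      \<comment> \<open>One factor \<open>m\<close> uses the gain, the other only
        \<open>m \<le> b\<close>.\<close>
      have "m\<^sup>2 \<le> (b - \<eta> / 2) * b"
        using m' m0 \<eta>(1) by (simp add: power2_eq_square mult_mono)
      also have "\<dots> \<le> b\<^sup>2 - \<eta> * \<epsilon> / 8"
        using mult_left_mono[OF b less_imp_le[OF \<eta>(1)]] unfolding power2_eq_square by argo
      also have "\<dots> \<le> (a\<^sup>2 + b\<^sup>2) / 2 - \<delta>"
        using power_mono[OF ab(1,2), of 2] \<delta>(3) by argo
      finally show ?thesis .
    qed
    then show ?thesis
      by (simp add: m_def a_def b_def)
  qed
  show ?thesis
  proof
    show "0 < \<delta>" by (fact \<delta>(1))
    fix x y :: 'a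
    assume "norm x \<le> R" "norm y \<le> R" "\<epsilon> \<le> norm (x - y)"
    then show "(norm ((x + y) /\<^sub>R 2))\<^sup>2 \<le> ((norm x)\<^sup>2 + (norm y)\<^sup>2) / 2 - \<delta>"
      using ordered[of x y] ordered[of y x]
      by (cases "norm y \<le> norm x") (auto simp: norm_minus_commute add.commute)
  qed
qed

text \<open>The midpoint of two near-minimisers lies in \<open>C\<close> and the linear term
  averages exactly, so the gain in the squared norm would undercut the infimum unless the two points
  are close. This gives both the Cauchy property and uniqueness.\<close>

lemma ex1_minimizer:
  fixes C :: "'a::banach set" and \<psi> :: "'a \<Rightarrow>\<^sub>L real"
  assumes uc: "uniformly_convex_space TYPE('a)"
    and C: "C \<noteq> {}" "closed C" "convex C"
  shows "\<exists>!y. y \<in> C \<and> (\<forall>z\<in>C. (norm y)\<^sup>2 - 2 * blinfun_apply \<psi> y \<le> (norm z)\<^sup>2 - 2 * blinfun_apply \<psi> z)"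
proof -
  define g where "g z = (norm z)\<^sup>2 - 2 * blinfun_apply \<psi> z" for z
  \<comment> \<open>Completing the square bounds \<open>g\<close> below and makes its sublevel sets
    bounded.\<close>
  have g_lower: "(norm z - norm \<psi>)\<^sup>2 - (norm \<psi>)\<^sup>2 \<le> g z" for z
    using norm_blinfun[of \<psi> z] by (simp add: g_def power2_eq_square algebra_simps)
  have "- (norm \<psi>)\<^sup>2 \<le> g z" for z
    using g_lower[of z] zero_le_power2[of "norm z - norm \<psi>"] by linarith
  then have bdd: "bdd_below (g ` C)"
    by (rule bdd_belowI2)
  define m where "m = Inf (g ` C)"
  have m: "m \<le> g z" if "z \<in> C" for z
    unfolding m_def using bdd that by (intro cInf_lower) auto
  \<comment> \<open>Sum of \<open>norm \<psi>\<close>, the 1 in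
    \<open>s \<le> 1 + s\<^sup>2\<close>, and the bound \<open>m + 1 + (norm \<psi>)\<^sup>2\<close>
    on \<open>s\<^sup>2\<close>.\<close>
  define R where "R = norm \<psi> + 2 + m + (norm \<psi>)\<^sup>2"
  have R: "norm z \<le> R" if "g z < m + 1" for z
  proof -
    define s where "s = norm z - norm \<psi>"
    have "s\<^sup>2 < m + 1 + (norm \<psi>)\<^sup>2"
      using g_lower[of z] that by (simp add: s_def)
    moreover have "s \<le> 1 + s\<^sup>2"
      using zero_le_power2[of "s - 1/2"] by (simp add: power2_eq_square algebra_simps)
    ultimately show ?thesis
      by (simp add: R_def s_def)
  qed
  have close: "\<exists>\<delta>>0. \<forall>x\<in>C. \<forall>y\<in>C. g x < m + \<delta> \<longrightarrow> g y < m + \<delta> \<longrightarrow> norm (x - y) < \<epsilon>"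
    if "0 < \<epsilon>" for \<epsilon>
  proof -
    obtain \<delta> where \<delta>: "0 < \<delta>"
      and mid: "\<And>x y::'a. norm x \<le> R \<Longrightarrow> norm y \<le> R \<Longrightarrow> \<epsilon> \<le> norm (x - y) \<Longrightarrow>
        (norm ((x + y) /\<^sub>R 2))\<^sup>2 \<le> ((norm x)\<^sup>2 + (norm y)\<^sup>2) / 2 - \<delta>"
      using uniformly_convex_midpoint_square[OF uc \<open>0 < \<epsilon>\<close>, of R] by blast
    \<comment> \<open>The 1 in the minimum puts both points in the ball of radius \<open>R\<close>;
      the \<open>\<delta>\<close> sends the midpoint value below \<open>m\<close>.\<close>
    have "norm (x - y) < \<epsilon>"
      if xy: "x \<in> C" "y \<in> C" "g x < m + min \<delta> 1" "g y < m + min \<delta> 1" for x y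
    proof (rule ccontr)
      assume "\<not> norm (x - y) < \<epsilon>"
      moreover define c where "c = (x + y) /\<^sub>R 2"
      ultimately have "(norm c)\<^sup>2 \<le> ((norm x)\<^sup>2 + (norm y)\<^sup>2) / 2 - \<delta>"
        unfolding c_def using xy by (intro mid R) auto
      moreover have "blinfun_apply \<psi> c = (blinfun_apply \<psi> x + blinfun_apply \<psi> y) / 2"
        by (simp add: c_def blinfun.add_right blinfun.scaleR_right)
      ultimately have "g c \<le> (g x + g y) / 2 - \<delta>"
        unfolding g_def by argo
      moreover have "c \<in> C"
        using convexD[OF C(3) xy(1,2), of "1/2" "1/2"]
        by (simp add: c_def scaleR_right_distrib inverse_eq_divide)
      then have "m \<le> g c"
        by (rule m)
      ultimately show False
        using xy min.cobounded1[of \<delta> 1] by argo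
    qed
    then show ?thesis
      using \<delta> by (intro exI[of _ "min \<delta> 1"]) auto
  qed
  have "\<exists>x\<in>C. g x < m + inverse (real (Suc n))" for n
  proof -
    have "Inf (g ` C) < m + inverse (real (Suc n))"
      by (simp add: m_def)
    then show ?thesis
      using C(1) by (subst (asm) cInf_less_iff[OF _ bdd]) auto
  qed
  then obtain X where X: "\<And>n. X n \<in> C" "\<And>n. g (X n) < m + inverse (real (Suc n))"
    by metis
  have X_small: "\<exists>N. \<forall>n\<ge>N. g (X n) < m + \<delta>" if "0 < \<delta>" for \<delta>
  proof -
    obtain N where N: "inverse (real (Suc N)) < \<delta>"
      using reals_Archimedean[OF \<open>0 < \<delta>\<close>] by auto
    have "g (X n) < m + \<delta>" if "N \<le> n" for n
    proof -
      have "inverse (real (Suc n)) \<le> inverse (real (Suc N))"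
        using that by (simp add: field_simps)
      then show ?thesis
        using X(2)[of n] N by linarith
    qed
    then show ?thesis
      by blast
  qed
  have "Cauchy X"
  proof (rule CauchyI)
    fix \<epsilon> :: real assume "0 < \<epsilon>"
    then obtain \<delta> where "0 < \<delta>"
      and \<delta>: "\<forall>x\<in>C. \<forall>y\<in>C. g x < m + \<delta> \<longrightarrow> g y < m + \<delta> \<longrightarrow> norm (x - y) < \<epsilon>"
      using close by blast
    then show "\<exists>M. \<forall>i\<ge>M. \<forall>j\<ge>M. norm (X i - X j) < \<epsilon>"
      using X_small[of \<delta>] X(1) by blast
  qed
  then obtain y where y: "X \<longlonglongrightarrow> y"
    using Cauchy_convergent_iff convergent_def by blast
  have yC: "y \<in> C"
    using closed_sequentially[OF C(2) _ y] X(1) by blast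
  have "(\<lambda>n. g (X n)) \<longlonglongrightarrow> g y"
    unfolding g_def by (intro tendsto_intros y)
  moreover have "(\<lambda>n. m + inverse (real (Suc n))) \<longlonglongrightarrow> m"
    using tendsto_add[OF tendsto_const LIMSEQ_inverse_real_of_nat, of m] by simp
  ultimately have "g y \<le> m"
    using X(2) by (intro LIMSEQ_le) (auto intro: less_imp_le simp del: of_nat_Suc)
  then have min_y: "\<forall>z\<in>C. g y \<le> g z"
    using m by force
  \<comment> \<open>Two distinct minimisers would be closer than their own distance.\<close>
  have "z = y" if z: "z \<in> C" "\<forall>w\<in>C. g z \<le> g w" for z
  proof (rule ccontr)
    assume "z \<noteq> y"
    then have "0 < norm (z - y)"
      by simp
    then obtain \<delta> where "0 < \<delta>"
      and \<delta>: "\<forall>x\<in>C. \<forall>y'\<in>C. g x < m + \<delta> \<longrightarrow> g y' < m + \<delta> \<longrightarrow> norm (x - y') < norm (z - y)"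
      using close by blast
    moreover have "g z \<le> m"
      using z(2) yC \<open>g y \<le> m\<close> by force
    ultimately have "norm (z - y) < norm (z - y)"
      using z(1) yC \<open>g y \<le> m\<close> by (intro \<delta>[rule_format]) auto
    then show False
      by simp
  qed
  then show ?thesis
    unfolding g_def[symmetric] using yC min_y by blast
qed

section \<open>Uniform smoothness and the duality mapping\<close>

text \<open>The factor 2 makes the limit as \<open>t\<close> tends to 0 from the right the
  directional derivative of half the squared norm, which will be \<open>duality_map w\<close>
  applied to \<open>h\<close>.\<close>

definition norm_square_quotient :: "'a::real_normed_vector \<Rightarrow> 'a \<Rightarrow> real \<Rightarrow> real" where
  "norm_square_quotient w h t = ((norm (w + t *\<^sub>R h))\<^sup>2 - (norm w)\<^sup>2) / (2 * t)"

text \<open>Every candidate for \<open>duality_map w\<close> is a subgradient of half the squared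
  norm at \<open>w\<close>, by the operator norm bound and the arithmetic-geometric mean
  inequality.\<close>

lemma functional_le_norm_square_quotient:
  assumes f: "blinfun_apply f w = (norm f)\<^sup>2" "(norm f)\<^sup>2 = (norm w)\<^sup>2" and "0 < t"
  shows "blinfun_apply f h \<le> norm_square_quotient w h t"
proof -
  have n: "norm f = norm w"
    using f(2) by simp
  have "(norm w)\<^sup>2 + t * blinfun_apply f h = blinfun_apply f (w + t *\<^sub>R h)"
    using f by (simp add: blinfun.add_right blinfun.scaleR_right)
  also have "\<dots> \<le> norm w * norm (w + t *\<^sub>R h)"
    using norm_blinfun[of f "w + t *\<^sub>R h"] n by simp
  also have "\<dots> \<le> ((norm w)\<^sup>2 + (norm (w + t *\<^sub>R h))\<^sup>2) / 2"
    using zero_le_power2[of "norm w - norm (w + t *\<^sub>R h)"]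
    by (simp add: power2_eq_square algebra_simps)
  finally show ?thesis
    using \<open>0 < t\<close> by (simp add: norm_square_quotient_def field_simps)
qed

lemma norm_square_quotient_le:
  assumes "0 < t"
  shows "norm_square_quotient w h t \<le> norm w * norm h + t * (norm h)\<^sup>2 / 2"
proof -
  have "(norm (w + t *\<^sub>R h))\<^sup>2 \<le> (norm w + t * norm h)\<^sup>2"
    using norm_triangle_ineq[of w "t *\<^sub>R h"] assms by (intro power_mono) auto
  then show ?thesis
    using assms by (simp add: norm_square_quotient_def field_simps power2_eq_square)
qed

text \<open>The square lies above its tangent:
  \<open>a\<^sup>2 - b\<^sup>2 \<ge> 2 * b * (a - b)\<close>. The bound is free of \<open>t\<close>,
  so the infimum over \<open>t\<close> exists.\<close>

lemma norm_square_quotient_ge: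
  assumes "0 < t"
  shows "- (norm w * norm h) \<le> norm_square_quotient w h t"
proof -
  define a b where "a = norm (w + t *\<^sub>R h)" and "b = norm w"
  have "b - a \<le> t * norm h"
    using norm_triangle_ineq4[of "w + t *\<^sub>R h" "t *\<^sub>R h"] assms by (simp add: a_def b_def)
  then have "(b - a) * b \<le> t * norm h * b"
    by (intro mult_right_mono) (auto simp: b_def)
  then have "- 2 * t * norm h * b \<le> a\<^sup>2 - b\<^sup>2"
    using zero_le_power2[of "a - b"] by (simp add: power2_eq_square algebra_simps)
  then show ?thesis
    using assms unfolding norm_square_quotient_def a_def[symmetric] b_def[symmetric]
    by (simp add: field_simps)
qed

lemma norm_square_convex:
  fixes x y :: "'a::real_normed_vector"
  assumes "0 \<le> s" "s \<le> 1"
  shows "(norm ((1 - s) *\<^sub>R x + s *\<^sub>R y))\<^sup>2 \<le> (1 - s) * (norm x)\<^sup>2 + s * (norm y)\<^sup>2"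
proof -
  have "norm ((1 - s) *\<^sub>R x + s *\<^sub>R y) \<le> (1 - s) * norm x + s * norm y"
    using norm_triangle_ineq[of "(1 - s) *\<^sub>R x" "s *\<^sub>R y"] assms by simp
  then have "(norm ((1 - s) *\<^sub>R x + s *\<^sub>R y))\<^sup>2 \<le> ((1 - s) * norm x + s * norm y)\<^sup>2"
    by (rule power_mono) simp
  also have "\<dots> = (1 - s) * (norm x)\<^sup>2 + s * (norm y)\<^sup>2 - s * (1 - s) * (norm x - norm y)\<^sup>2"
    by (simp add: power2_eq_square algebra_simps)
  also have "\<dots> \<le> (1 - s) * (norm x)\<^sup>2 + s * (norm y)\<^sup>2"
    using assms by simp
  finally show ?thesis .
qed

text \<open>By convexity of the squared norm, since \<open>w + t *\<^sub>R h\<close> lies on the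
  segment from \<open>w\<close> to \<open>w + t' *\<^sub>R h\<close>.\<close>

lemma norm_square_quotient_mono:
  assumes "0 < t" "t \<le> t'"
  shows "norm_square_quotient w h t \<le> norm_square_quotient w h t'"
proof -
  define s where "s = t / t'"
  have s: "0 \<le> s" "s \<le> 1" "t = s * t'"
    using assms by (auto simp: s_def)
  have "(1 - s) *\<^sub>R w + s *\<^sub>R (w + t' *\<^sub>R h) = w + t *\<^sub>R h"
    by (simp add: s(3) algebra_simps)
  then have "(norm (w + t *\<^sub>R h))\<^sup>2 \<le> (1 - s) * (norm w)\<^sup>2 + s * (norm (w + t' *\<^sub>R h))\<^sup>2"
    using norm_square_convex[OF s(1,2), of w "w + t' *\<^sub>R h"] by simp
  then have "(norm (w + t *\<^sub>R h))\<^sup>2 - (norm w)\<^sup>2 \<le> s * ((norm (w + t' *\<^sub>R h))\<^sup>2 - (norm w)\<^sup>2)"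
    by (simp add: algebra_simps)
  then have "norm_square_quotient w h t \<le> s * ((norm (w + t' *\<^sub>R h))\<^sup>2 - (norm w)\<^sup>2) / (2 * t)"
    unfolding norm_square_quotient_def using assms by (intro divide_right_mono) auto
  also have "\<dots> = norm_square_quotient w h t'"
    using assms by (simp add: norm_square_quotient_def s_def)
  finally show ?thesis .
qed

text \<open>The point on the left is the midpoint of \<open>w + (2 * t) *\<^sub>R h\<close> and
  \<open>w + (2 * t) *\<^sub>R k\<close>. The doubled step is harmless in the limit, which becomes
  subadditive.\<close>

lemma norm_square_quotient_add:
  assumes "0 < t"
  shows "norm_square_quotient w (h + k) t \<le>
    norm_square_quotient w h (2 * t) + norm_square_quotient w k (2 * t)"
proof -
  have "(1 - 1/2) *\<^sub>R (w + (2 * t) *\<^sub>R h) + (1/2) *\<^sub>R (w + (2 * t) *\<^sub>R k) =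
      (1/2 + 1/2) *\<^sub>R w + t *\<^sub>R (h + k)"
    unfolding scaleR_add_left by (simp add: algebra_simps)
  then have "(norm (w + t *\<^sub>R (h + k)))\<^sup>2 \<le>
      ((norm (w + (2 * t) *\<^sub>R h))\<^sup>2 + (norm (w + (2 * t) *\<^sub>R k))\<^sup>2) / 2"
    using norm_square_convex[of "1/2" "w + (2 * t) *\<^sub>R h" "w + (2 * t) *\<^sub>R k"] by simp
  then have "norm_square_quotient w (h + k) t \<le>
      (((norm (w + (2 * t) *\<^sub>R h))\<^sup>2 + (norm (w + (2 * t) *\<^sub>R k))\<^sup>2) / 2 - (norm w)\<^sup>2) / (2 * t)"
    unfolding norm_square_quotient_def using assms by (intro divide_right_mono) auto
  also have "\<dots> = norm_square_quotient w h (2 * t) + norm_square_quotient w k (2 * t)"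
    using assms by (simp add: norm_square_quotient_def field_simps)
  finally show ?thesis .
qed

lemma norm_square_quotient_scale:
  assumes "0 < c"
  shows "norm_square_quotient w (c *\<^sub>R h) t = c * norm_square_quotient w h (c * t)"
  using assms by (simp add: norm_square_quotient_def mult.commute)

text \<open>This will make the one-sided derivative odd. With \<open>p\<close> and \<open>q\<close>
  the norms of \<open>w + t *\<^sub>R h\<close> and \<open>w - t *\<^sub>R h\<close>, smoothness
  controls \<open>p + q\<close> to first order and the triangle inequality makes
  \<open>(p - q)\<^sup>2\<close> of second order; together they control
  \<open>p\<^sup>2 + q\<^sup>2\<close>.\<close>

lemma norm_square_quotient_symmetric_small:
  fixes w h :: "'a::real_normed_vector"
  assumes us: "uniformly_smooth_space TYPE('a)" and "0 < e"
  obtains t0 where "0 < t0"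
    and "\<And>t. 0 < t \<Longrightarrow> t \<le> t0 \<Longrightarrow> norm_square_quotient w h t + norm_square_quotient w (- h) t \<le> e"
proof (cases "w = 0")
  case True
  \<comment> \<open>The zero vector cannot be normalised, but here the sum is explicit.\<close>
  have "norm_square_quotient w h t + norm_square_quotient w (- h) t = t * (norm h)\<^sup>2" if "0 < t" for t
    using that True by (simp add: norm_square_quotient_def power2_eq_square field_simps)
  moreover have "t * (norm h)\<^sup>2 \<le> e" if "0 < t" "t \<le> e / (1 + (norm h)\<^sup>2)" for t
  proof -
    have "t * (norm h)\<^sup>2 \<le> t * (1 + (norm h)\<^sup>2)"
      using that by simp
    also have "\<dots> \<le> e"
      using that by (simp add: pos_le_divide_eq add_pos_nonneg)
    finally show ?thesis .
  qed
  ultimately show ?thesis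
    using \<open>0 < e\<close> that[of "e / (1 + (norm h)\<^sup>2)"] by (simp add: add_pos_nonneg)
next
  case False
  define a H where "a = norm w" and "H = norm h"
  have a: "0 < a" and H: "0 \<le> H"
    using False by (auto simp: a_def H_def)
  have aH: "0 < a * H + 1"
    using a H by (simp add: add_nonneg_pos)
  \<comment> \<open>Makes the first-order term \<open>2 * \<epsilon> * (a * H)\<close> at most
    \<open>e / 2\<close>; the added 1 covers \<open>h = 0\<close>.\<close>
  define \<epsilon> where "\<epsilon> = e / (4 * (a * H + 1))"
  have \<epsilon>: "0 < \<epsilon>"
    using \<open>0 < e\<close> aH by (simp add: \<epsilon>_def)
  have \<epsilon>_small: "2 * \<epsilon> * (a * H) \<le> e / 2"
  proof -
    have "2 * \<epsilon> * (a * H) \<le> 2 * \<epsilon> * (a * H + 1)"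
      using \<epsilon> by simp
    also have "\<dots> = e / 2"
      using aH by (simp add: \<epsilon>_def divide_simps)
    finally show ?thesis .
  qed
  obtain \<delta> where \<delta>: "0 < \<delta>"
    and smooth: "\<And>x y::'a. norm x = 1 \<Longrightarrow> norm y \<le> \<delta> \<Longrightarrow>
      (norm (x + y) + norm (x - y)) / 2 - 1 \<le> \<epsilon> * norm y"
    using us \<epsilon> unfolding uniformly_smooth_space_def by blast
  define K where "K = (\<epsilon>\<^sup>2 + 1) * H\<^sup>2 + 1"
  have K: "0 < K"
    unfolding K_def by (intro add_nonneg_pos mult_nonneg_nonneg) auto
  \<comment> \<open>The first bound brings \<open>(t / a) *\<^sub>R h\<close> within
    \<open>\<delta>\<close> of 0, the second makes the second-order term at most
    \<open>e / 2\<close>.\<close>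
  define t0 where "t0 = min (\<delta> * a / (H + 1)) (e / (2 * K))"
  have t0: "0 < t0"
    using \<delta> a H K \<open>0 < e\<close> by (simp add: t0_def add_nonneg_pos)
  have "norm_square_quotient w h t + norm_square_quotient w (- h) t \<le> e" if t: "0 < t" "t \<le> t0" for t
  proof -
    have "t * (H + 1) \<le> \<delta> * a"
      using t H by (simp add: t0_def pos_le_divide_eq add_nonneg_pos)
    then have "t * H \<le> \<delta> * a"
      using t by (simp add: algebra_simps)
    then have "norm ((t / a) *\<^sub>R h) \<le> \<delta>"
      using t a by (simp add: H_def[symmetric] field_simps)
    moreover have "norm (w /\<^sub>R a) = 1"
      using a by (simp add: a_def)
    ultimately have "(norm (w /\<^sub>R a + (t / a) *\<^sub>R h) + norm (w /\<^sub>R a - (t / a) *\<^sub>R h)) / 2 - 1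
        \<le> \<epsilon> * norm ((t / a) *\<^sub>R h)"
      by (rule smooth[rotated])
    moreover define p q where "p = norm (w + t *\<^sub>R h)" and "q = norm (w - t *\<^sub>R h)"
    have "w /\<^sub>R a + (t / a) *\<^sub>R h = (1 / a) *\<^sub>R (w + t *\<^sub>R h)"
      "w /\<^sub>R a - (t / a) *\<^sub>R h = (1 / a) *\<^sub>R (w - t *\<^sub>R h)"
      by (simp_all add: scaleR_right_distrib scaleR_right_diff_distrib inverse_eq_divide)
    then have "norm (w /\<^sub>R a + (t / a) *\<^sub>R h) = p / a" "norm (w /\<^sub>R a - (t / a) *\<^sub>R h) = q / a"
      using a by (simp_all only: norm_scaleR p_def q_def) simp_all
    moreover have "norm ((t / a) *\<^sub>R h) = t * H / a"
      using a t by (simp add: H_def)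
    ultimately have "(p / a + q / a) / 2 - 1 \<le> \<epsilon> * (t * H / a)"
      by (simp only:)
    then have "2 * a * ((p / a + q / a) / 2 - 1) \<le> 2 * a * (\<epsilon> * (t * H / a))"
      using a by (intro mult_left_mono) auto
    moreover have "2 * a * ((p / a + q / a) / 2 - 1) = p + q - 2 * a"
      using a by (simp add: right_diff_distrib distrib_left)
    moreover have "2 * a * (\<epsilon> * (t * H / a)) = 2 * (\<epsilon> * t * H)"
      using a by simp
    ultimately have sum: "p + q \<le> 2 * (a + \<epsilon> * t * H)"
      by argo
    have "\<bar>p - q\<bar> \<le> norm ((w + t *\<^sub>R h) - (w - t *\<^sub>R h))"
      unfolding p_def q_def by (rule norm_triangle_ineq3)
    also have "(w + t *\<^sub>R h) - (w - t *\<^sub>R h) = (2 * t) *\<^sub>R h"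
      by (simp flip: scaleR_2)
    also have "norm \<dots> = 2 * t * H"
      using t by (simp add: H_def)
    finally have "(p - q)\<^sup>2 \<le> (2 * t * H)\<^sup>2"
      by (metis abs_ge_zero power2_abs power_mono)
    moreover have "(p + q)\<^sup>2 \<le> (2 * (a + \<epsilon> * t * H))\<^sup>2"
      using sum by (intro power_mono) (auto simp: p_def q_def)
    moreover have "p\<^sup>2 + q\<^sup>2 = ((p + q)\<^sup>2 + (p - q)\<^sup>2) / 2"
      by (simp add: power2_eq_square field_simps)
    ultimately have "p\<^sup>2 + q\<^sup>2 - 2 * a\<^sup>2 \<le> 2 * (a + \<epsilon> * t * H)\<^sup>2 + 2 * (t * H)\<^sup>2 - 2 * a\<^sup>2"
      unfolding power_mult_distrib by (simp add: field_simps)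
    also have "\<dots> = 2 * t * (2 * \<epsilon> * (a * H) + t * ((\<epsilon>\<^sup>2 + 1) * H\<^sup>2))"
      by (simp add: power2_eq_square algebra_simps)
    also have "\<dots> \<le> 2 * t * e"
    proof -
      have "t * ((\<epsilon>\<^sup>2 + 1) * H\<^sup>2) \<le> t * K"
        using t by (simp add: K_def)
      also have "\<dots> \<le> e / 2"
        using t K by (simp add: t0_def pos_le_divide_eq mult_ac)
      finally show ?thesis
        using \<epsilon>_small t by simp
    qed
    finally have "(p\<^sup>2 + q\<^sup>2 - 2 * a\<^sup>2) / (2 * t) \<le> e"
      using t by (simp add: pos_divide_le_eq mult.commute)
    moreover have "norm_square_quotient w h t + norm_square_quotient w (- h) t =
        (p\<^sup>2 + q\<^sup>2 - 2 * a\<^sup>2) / (2 * t)"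
      by (simp add: norm_square_quotient_def p_def q_def a_def flip: add_divide_distrib)
    ultimately show ?thesis
      by simp
  qed
  then show ?thesis
    using t0 that by blast
qed

text \<open>The one-sided derivative is subadditive and positively homogeneous by convexity.
  Smoothness makes it odd, hence linear, so it is itself the required functional.\<close>

lemma norm_square_derivative:
  fixes w :: "'a::real_normed_vector"
  assumes us: "uniformly_smooth_space TYPE('a)"
  obtains f :: "'a \<Rightarrow>\<^sub>L real"
  where "blinfun_apply f w = (norm f)\<^sup>2" and "(norm f)\<^sup>2 = (norm w)\<^sup>2"
    and "\<And>h e. 0 < e \<Longrightarrow>
      \<exists>t0>0. \<forall>t. 0 < t \<longrightarrow> t \<le> t0 \<longrightarrow> norm_square_quotient w h t < blinfun_apply f h + e"
proof -
  \<comment> \<open>As the quotient is nondecreasing in \<open>t\<close>, this infimum is its limit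
    from the right at 0.\<close>
  define p where "p h = Inf (norm_square_quotient w h ` {0<..})" for h
  have bdd: "bdd_below (norm_square_quotient w h ` {0<..})" for h
    by (rule bdd_belowI2[of _ "- (norm w * norm h)"]) (simp add: norm_square_quotient_ge)
  have p_le: "p h \<le> norm_square_quotient w h t" if "0 < t" for h t
    unfolding p_def using that by (intro cInf_lower bdd) auto
  have p_approx: "\<exists>t0>0. \<forall>t. 0 < t \<longrightarrow> t \<le> t0 \<longrightarrow> norm_square_quotient w h t < p h + e"
    if "0 < e" for h e
  proof -
    have "Inf (norm_square_quotient w h ` {0<..}) < p h + e"
      using that by (simp add: p_def)
    then obtain t0 where "0 < t0" "norm_square_quotient w h t0 < p h + e"
      by (subst (asm) cInf_less_iff[OF _ bdd]) auto
    then show ?thesis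
      using norm_square_quotient_mono[of _ t0 w h] by (intro exI[of _ t0]) force
  qed
  have p_add_le: "p (h + k) \<le> p h + p k" for h k
  proof (rule field_le_epsilon)
    fix e :: real assume "0 < e"
    then have e2: "0 < e / 2"
      by simp
    obtain t1 t2 where t: "0 < t1" "0 < t2"
      and t1: "\<And>t. 0 < t \<Longrightarrow> t \<le> t1 \<Longrightarrow> norm_square_quotient w h t < p h + e / 2"
      and t2: "\<And>t. 0 < t \<Longrightarrow> t \<le> t2 \<Longrightarrow> norm_square_quotient w k t < p k + e / 2"
      using p_approx[OF e2] by metis
    \<comment> \<open>Halved because subadditivity of the quotients doubles the step.\<close>
    define t where "t = min t1 t2 / 2"
    have "0 < t" "2 * t \<le> t1" "2 * t \<le> t2"
      using t by (auto simp: t_def)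
    then show "p (h + k) \<le> p h + p k + e"
      using p_le[of t "h + k"] norm_square_quotient_add[of t w h k] t1[of "2 * t"] t2[of "2 * t"]
      by linarith
  qed
  have p_scale_le: "p (c *\<^sub>R h) \<le> c * p h" if "0 < c" for c h
  proof (rule field_le_epsilon)
    fix e :: real assume "0 < e"
    then have "0 < e / c"
      using that by simp
    then obtain t0 where "0 < t0" "norm_square_quotient w h t0 < p h + e / c"
      using p_approx by blast
    then have "c * norm_square_quotient w h t0 \<le> c * p h + e"
      using that by (simp add: field_simps)
    moreover have "norm_square_quotient w (c *\<^sub>R h) (t0 / c) = c * norm_square_quotient w h t0"
      using norm_square_quotient_scale[OF that, of w h "t0 / c"] that by simp
    ultimately show "p (c *\<^sub>R h) \<le> c * p h + e"
      using p_le[of "t0 / c" "c *\<^sub>R h"] \<open>0 < t0\<close> that by simp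
  qed
  have p_scale_pos: "p (c *\<^sub>R h) = c * p h" if "0 < c" for c h
  proof (rule antisym)
    have "p h \<le> inverse c * p (c *\<^sub>R h)"
      using p_scale_le[of "inverse c" "c *\<^sub>R h"] that by simp
    then show "c * p h \<le> p (c *\<^sub>R h)"
      using that by (simp add: field_simps)
  qed (rule p_scale_le[OF that])
  have p0: "p 0 = 0"
    by (simp add: p_def norm_square_quotient_def)
  have p_minus: "p (- h) = - p h" for h
  proof (rule antisym)
    show "- p h \<le> p (- h)"
      using p_add_le[of h "- h"] p0 by simp
    show "p (- h) \<le> - p h"
    proof (rule field_le_epsilon)
      fix e :: real assume "0 < e"
      then obtain t0 where t0: "0 < t0"
        and "norm_square_quotient w h t0 + norm_square_quotient w (- h) t0 \<le> e"
        using norm_square_quotient_symmetric_small[OF us, of e w h] by blast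
      then show "p (- h) \<le> - p h + e"
        using p_le[of t0 h] p_le[of t0 "- h"] by linarith
    qed
  qed
  \<comment> \<open>Oddness turns subadditivity at \<open>- h\<close> and \<open>- k\<close> into
    the reverse inequality.\<close>
  have p_add: "p (h + k) = p h + p k" for h k
    using p_add_le[of h k] p_add_le[of "- h" "- k"] p_minus[of "h + k"] by (simp add: p_minus)
  have p_scale: "p (c *\<^sub>R h) = c * p h" for c h
  proof (cases c "0::real" rule: linorder_cases)
    case less
    then show ?thesis
      using p_scale_pos[of "- c" h] p_minus[of "c *\<^sub>R h"] by simp
  qed (auto simp: p0 p_scale_pos)
  have p_bound: "p h \<le> norm w * norm h" for h
  proof (rule field_le_epsilon)
    fix e :: real assume "0 < e"
    define t where "t = 2 * e / (1 + (norm h)\<^sup>2)"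
    have t: "0 < t"
      using \<open>0 < e\<close> by (simp add: t_def add_pos_nonneg)
    have "t * (norm h)\<^sup>2 \<le> t * (1 + (norm h)\<^sup>2)"
      using t by simp
    also have "\<dots> = 2 * e"
      using add_pos_nonneg[of 1 "(norm h)\<^sup>2"] by (simp add: t_def)
    finally show "p h \<le> norm w * norm h + e"
      using p_le[OF t, of h] norm_square_quotient_le[OF t, of w h] by linarith
  qed
  have p_abs: "\<bar>p h\<bar> \<le> norm w * norm h" for h
    using p_bound[of h] p_bound[of "- h"] by (simp add: p_minus)
  have bl: "bounded_linear p"
    by (rule bounded_linear_intro[of p "norm w"]) (use p_abs in \<open>auto simp: p_add p_scale mult.commute\<close>)
  \<comment> \<open>In the direction \<open>w\<close> the quotient is
    \<open>(norm w)\<^sup>2 * (1 + t / 2)\<close>.\<close>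
  have p_w: "(norm w)\<^sup>2 \<le> p w"
    unfolding p_def
  proof (rule cInf_greatest)
    fix x assume "x \<in> norm_square_quotient w w ` {0<..}"
    then obtain t where t: "0 < t" and x: "x = norm_square_quotient w w t"
      by auto
    have "w + t *\<^sub>R w = (1 + t) *\<^sub>R w"
      by (simp add: scaleR_left_distrib)
    then have "x = (norm w)\<^sup>2 * (1 + t / 2)"
      using t by (simp add: x norm_square_quotient_def power_mult_distrib)
        (simp add: power2_eq_square field_simps)
    then show "(norm w)\<^sup>2 \<le> x"
      using t by (simp add: algebra_simps)
  qed auto
  define f where "f = Blinfun p"
  have f: "blinfun_apply f = p"
    unfolding f_def by (rule bounded_linear_Blinfun_apply[OF bl])
  have f_w: "blinfun_apply f w = (norm w)\<^sup>2"
    using p_w p_bound[of w] by (simp add: f power2_eq_square)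
  have "norm f \<le> norm w"
    by (rule norm_blinfun_bound) (auto simp: f p_abs)
  moreover have "norm w \<le> norm f"
  proof (cases "w = 0")
    case False
    have "norm w * norm w \<le> norm f * norm w"
      using norm_blinfun[of f w] f_w by (simp add: power2_eq_square)
    then show ?thesis
      using False by simp
  qed simp
  ultimately have "norm f = norm w"
    by simp
  then show ?thesis
    using that[of f] f_w p_approx by (simp add: f)
qed

text \<open>Identifies \<open>duality_map w\<close> with the derivative: any other candidate is a
  subgradient, hence lies below \<open>f\<close> in every direction, and comparing \<open>h\<close>
  with \<open>- h\<close> forces equality.\<close>

lemma duality_map_props:
  fixes w :: "'a::real_normed_vector"
  assumes us: "uniformly_smooth_space TYPE('a)"
  shows duality_map_le: "0 < t \<Longrightarrow> blinfun_apply (duality_map w) h \<le> norm_square_quotient w h t"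
    and duality_map_approx: "0 < e \<Longrightarrow>
      \<exists>t0>0. \<forall>t. 0 < t \<longrightarrow> t \<le> t0 \<longrightarrow>
        norm_square_quotient w h t < blinfun_apply (duality_map w) h + e"
proof -
  obtain f :: "'a \<Rightarrow>\<^sub>L real" where f: "blinfun_apply f w = (norm f)\<^sup>2" "(norm f)\<^sup>2 = (norm w)\<^sup>2"
    and approx: "\<And>h e. 0 < e \<Longrightarrow>
      \<exists>t0>0. \<forall>t. 0 < t \<longrightarrow> t \<le> t0 \<longrightarrow> norm_square_quotient w h t < blinfun_apply f h + e"
    using norm_square_derivative[OF us, of w] by blast
  have "f' = f" if f': "blinfun_apply f' w = (norm f')\<^sup>2" "(norm f')\<^sup>2 = (norm w)\<^sup>2" for f'
  proof (rule blinfun_eqI)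
    fix h
    have le: "blinfun_apply f' h \<le> blinfun_apply f h" for h
    proof (rule field_le_epsilon)
      fix e :: real assume "0 < e"
      then obtain t where "0 < t" "norm_square_quotient w h t < blinfun_apply f h + e"
        using approx by blast
      then show "blinfun_apply f' h \<le> blinfun_apply f h + e"
        using functional_le_norm_square_quotient[OF f', of t h] by linarith
    qed
    show "blinfun_apply f' h = blinfun_apply f h"
      using le[of h] le[of "- h"] by (simp add: blinfun.minus_right)
  qed
  then have J: "duality_map w = f"
    unfolding duality_map_def using f by (intro the_equality) blast+
  show "0 < t \<Longrightarrow> blinfun_apply (duality_map w) h \<le> norm_square_quotient w h t"
    unfolding J by (rule functional_le_norm_square_quotient[OF f])
  show "0 < e \<Longrightarrow> \<exists>t0>0. \<forall>t. 0 < t \<longrightarrow> t \<le> t0 \<longrightarrow>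
      norm_square_quotient w h t < blinfun_apply (duality_map w) h + e"
    unfolding J by (rule approx)
qed

section \<open>Variational inequality and surjectivity of the duality mapping\<close>

text \<open>First-order condition of a convex problem. A minimiser is compared with points of the
  segment towards \<open>z\<close>; conversely, the subgradient inequality with step 1 gives
  minimality.\<close>

lemma minimizer_iff:
  fixes C :: "'a::real_normed_vector set"
  assumes us: "uniformly_smooth_space TYPE('a)" and C: "convex C" and y: "y \<in> C"
  shows "(\<forall>z\<in>C. (norm y)\<^sup>2 - 2 * blinfun_apply \<psi> y \<le> (norm z)\<^sup>2 - 2 * blinfun_apply \<psi> z) \<longleftrightarrow>
    (\<forall>z\<in>C. blinfun_apply \<psi> (z - y) \<le> blinfun_apply (duality_map y) (z - y))"
proof
  assume min: "\<forall>z\<in>C. (norm y)\<^sup>2 - 2 * blinfun_apply \<psi> y \<le> (norm z)\<^sup>2 - 2 * blinfun_apply \<psi> z"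
  show "\<forall>z\<in>C. blinfun_apply \<psi> (z - y) \<le> blinfun_apply (duality_map y) (z - y)"
  proof (rule ballI, rule field_le_epsilon)
    fix z and e :: real
    assume z: "z \<in> C" and "0 < e"
    obtain t0 where "0 < t0" and t0: "\<And>t. 0 < t \<Longrightarrow> t \<le> t0 \<Longrightarrow>
        norm_square_quotient y (z - y) t < blinfun_apply (duality_map y) (z - y) + e"
      using duality_map_approx[OF us \<open>0 < e\<close>] by blast
    \<comment> \<open>At most 1 to stay in \<open>C\<close>, at most \<open>t0\<close> to be within
      \<open>e\<close> of the derivative.\<close>
    define t where "t = min t0 1"
    have t: "0 < t" "t \<le> t0" "t \<le> 1"
      using \<open>0 < t0\<close> by (auto simp: t_def)
    have "y + t *\<^sub>R (z - y) = (1 - t) *\<^sub>R y + t *\<^sub>R z"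
      by (simp add: algebra_simps)
    then have "y + t *\<^sub>R (z - y) \<in> C"
      using convexD[OF C y z, of "1 - t" t] t by simp
    then have "2 * t * blinfun_apply \<psi> (z - y) \<le> (norm (y + t *\<^sub>R (z - y)))\<^sup>2 - (norm y)\<^sup>2"
      using bspec[OF min, of "y + t *\<^sub>R (z - y)"]
      by (simp add: blinfun.add_right blinfun.scaleR_right)
    then have "blinfun_apply \<psi> (z - y) \<le> norm_square_quotient y (z - y) t"
      using t by (simp add: norm_square_quotient_def pos_le_divide_eq mult.commute)
    then show "blinfun_apply \<psi> (z - y) \<le> blinfun_apply (duality_map y) (z - y) + e"
      using t0[of t] t by linarith
  qed
next
  assume var: "\<forall>z\<in>C. blinfun_apply \<psi> (z - y) \<le> blinfun_apply (duality_map y) (z - y)"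
  show "\<forall>z\<in>C. (norm y)\<^sup>2 - 2 * blinfun_apply \<psi> y \<le> (norm z)\<^sup>2 - 2 * blinfun_apply \<psi> z"
  proof
    fix z assume "z \<in> C"
    then have "blinfun_apply \<psi> (z - y) \<le> norm_square_quotient y (z - y) 1"
      using var duality_map_le[OF us, of 1 y "z - y"] by force
    then show "(norm y)\<^sup>2 - 2 * blinfun_apply \<psi> y \<le> (norm z)\<^sup>2 - 2 * blinfun_apply \<psi> z"
      by (simp add: norm_square_quotient_def blinfun.diff_right)
  qed
qed

text \<open>On the whole space \<open>z - y\<close> is an arbitrary direction, and an inequality
  between linear functionals in all directions is an equality.\<close>

lemma duality_map_surj:
  assumes uc: "uniformly_convex_space TYPE('a::banach)" and us: "uniformly_smooth_space TYPE('a)"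
  shows "surj (duality_map :: 'a \<Rightarrow> _)"
  unfolding surj_def
proof
  fix \<psi> :: "'a \<Rightarrow>\<^sub>L real"
  obtain y :: 'a where
    "\<forall>z\<in>UNIV. (norm y)\<^sup>2 - 2 * blinfun_apply \<psi> y \<le> (norm z)\<^sup>2 - 2 * blinfun_apply \<psi> z"
    using ex1_minimizer[OF uc, of UNIV \<psi>] by auto
  then have var: "\<forall>z\<in>UNIV. blinfun_apply \<psi> (z - y) \<le> blinfun_apply (duality_map y) (z - y)"
    by (subst (asm) minimizer_iff[OF us]) auto
  have le: "blinfun_apply \<psi> h \<le> blinfun_apply (duality_map y) h" for h
    using bspec[OF var, of "y + h"] by simp
  have "\<psi> = duality_map y"
  proof (rule blinfun_eqI)
    show "blinfun_apply \<psi> h = blinfun_apply (duality_map y) h" for h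
      using le[of h] le[of "- h"] by (simp add: blinfun.minus_right)
  qed
  then show "\<exists>y. \<psi> = duality_map y" ..
qed

section \<open>Faces and projections\<close>

lemma eq_the_iff:
  assumes "\<exists>!x. P x"
  shows "y = (THE x. P x) \<longleftrightarrow> P y"
  using assms by (metis theI)

text \<open>Nearest points of \<open>C\<close> to \<open>x = u + y\<close> correspond to elements of
  least norm in \<open>D\<close>, the set of differences \<open>x - z\<close>, and \<open>y\<close>
  corresponds to \<open>u\<close>. This is why the duality mapping is evaluated at
  \<open>u\<close>.\<close>

lemma eq_metric_projection_iff:
  fixes C :: "'a::banach set"
  assumes uc: "uniformly_convex_space TYPE('a)" and us: "uniformly_smooth_space TYPE('a)"
    and C: "C \<noteq> {}" "closed C" "convex C" and y: "y \<in> C"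
  shows "y = metric_projection C (u + y) \<longleftrightarrow> y \<in> face C (duality_map u)"
proof -
  define x where "x = u + y"
  define D where "D = (\<lambda>z. x - z) ` C"
  have D: "D \<noteq> {}" "closed D" "convex D"
  proof -
    have "D = (+) x ` (uminus ` C)"
      by (auto simp: D_def image_image)
    then show "closed D" "convex D" "D \<noteq> {}"
      using C by (auto intro: closed_translation closed_negations convex_translation convex_negations)
  qed
  \<comment> \<open>The zero functional puts the least-norm problem into the form treated
    above.\<close>
  have min_iff: "(\<forall>v\<in>D. (norm (x - z))\<^sup>2 - 2 * blinfun_apply 0 (x - z) \<le> (norm v)\<^sup>2 - 2 * blinfun_apply 0 v)
      \<longleftrightarrow> (\<forall>z'\<in>C. norm (x - z) \<le> norm (x - z'))" for z
    by (simp add: D_def power_mono_iff)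
  obtain v where v: "v \<in> D" "\<forall>w\<in>D. (norm v)\<^sup>2 - 2 * blinfun_apply 0 v \<le> (norm w)\<^sup>2 - 2 * blinfun_apply 0 w"
    and v_unique: "\<And>v'. v' \<in> D \<Longrightarrow>
      (\<forall>w\<in>D. (norm v')\<^sup>2 - 2 * blinfun_apply 0 v' \<le> (norm w)\<^sup>2 - 2 * blinfun_apply 0 w) \<Longrightarrow> v' = v"
    using ex1_minimizer[OF uc D, of 0] by blast
  have ex1: "\<exists>!z. z \<in> C \<and> (\<forall>z'\<in>C. norm (x - z) \<le> norm (x - z'))"
  proof (rule ex1I[of _ "x - v"])
    show "x - v \<in> C \<and> (\<forall>z'\<in>C. norm (x - (x - v)) \<le> norm (x - z'))"
      using v min_iff[of "x - v"] by (auto simp: D_def)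
    fix z assume z: "z \<in> C \<and> (\<forall>z'\<in>C. norm (x - z) \<le> norm (x - z'))"
    then have "x - z = v"
      using min_iff[of z] by (intro v_unique) (auto simp: D_def)
    then show "z = x - v"
      by auto
  qed
  have u: "u = x - y" "u \<in> D"
    using y by (auto simp: x_def D_def)
  have "y = metric_projection C (u + y) \<longleftrightarrow> (\<forall>z\<in>C. norm (x - y) \<le> norm (x - z))"
    unfolding metric_projection_def x_def[symmetric] eq_the_iff[OF ex1] using y by simp
  also have "\<dots> \<longleftrightarrow> (\<forall>v\<in>D. blinfun_apply 0 (v - u) \<le> blinfun_apply (duality_map u) (v - u))"
    using minimizer_iff[OF us D(3) u(2), of 0] min_iff[of y] by (simp only: flip: u(1))
  \<comment> \<open>For \<open>v = x - z\<close> the difference \<open>v - u\<close> is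
    \<open>y - z\<close>.\<close>
  also have "\<dots> \<longleftrightarrow> (\<forall>z\<in>C. blinfun_apply (duality_map u) z \<le> blinfun_apply (duality_map u) y)"
    by (simp add: D_def x_def blinfun.add_right blinfun.diff_right)
  also have "\<dots> \<longleftrightarrow> y \<in> face C (duality_map u)"
    using y by (simp add: face_iff)
  finally show ?thesis .
qed

text \<open>The term \<open>duality_map y\<close> added to \<open>\<psi>\<close> cancels the
  derivative at \<open>y\<close> in the variational inequality, which leaves
  \<open>blinfun_apply \<psi> (z - y) \<le> 0\<close> on \<open>C\<close>.\<close>

lemma eq_generalized_projection_iff:
  fixes C :: "'a::banach set"
  assumes uc: "uniformly_convex_space TYPE('a)" and us: "uniformly_smooth_space TYPE('a)"
    and C: "C \<noteq> {}" "closed C" "convex C" and y: "y \<in> C"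
  shows "y = generalized_projection C (\<psi> + duality_map y) \<longleftrightarrow> y \<in> face C \<psi>"
proof -
  define \<phi> where "\<phi> = \<psi> + duality_map y"
  have V: "V_functional \<phi> a \<le> V_functional \<phi> b \<longleftrightarrow>
      (norm a)\<^sup>2 - 2 * blinfun_apply \<phi> a \<le> (norm b)\<^sup>2 - 2 * blinfun_apply \<phi> b" for a b
    by (auto simp: V_functional_def)
  have "y = generalized_projection C \<phi> \<longleftrightarrow>
      (\<forall>z\<in>C. (norm y)\<^sup>2 - 2 * blinfun_apply \<phi> y \<le> (norm z)\<^sup>2 - 2 * blinfun_apply \<phi> z)"
    unfolding generalized_projection_def V eq_the_iff[OF ex1_minimizer[OF uc C, of \<phi>]]
    using y by simp
  also have "\<dots> \<longleftrightarrow> (\<forall>z\<in>C. blinfun_apply \<phi> (z - y) \<le> blinfun_apply (duality_map y) (z - y))"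
    by (rule minimizer_iff[OF us C(3) y])
  also have "\<dots> \<longleftrightarrow> y \<in> face C \<psi>"
    using y by (simp add: \<phi>_def face_iff blinfun.add_left blinfun.diff_right)
  finally show ?thesis
    unfolding \<phi>_def .
qed

theorem theorem5p7:
  fixes C :: "'a::banach set"
  assumes "uniformly_convex_space TYPE('a)"
    and "uniformly_smooth_space TYPE('a)"
    and "C \<noteq> {}" and "closed C" and "convex C"
  shows "(\<forall>u::'a.
            face C (duality_map u) = {y \<in> C. y = metric_projection C (u + y)} \<and>
            {y \<in> C. y = metric_projection C (u + y)} =
              {y \<in> C. y = generalized_projection C (duality_map u + duality_map y)}) \<and>
         (\<forall>\<psi>::'a \<Rightarrow>\<^sub>L real.
            face C \<psi> = {y \<in> C. y = metric_projection C (dual_duality_map \<psi> + y)} \<and>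
            {y \<in> C. y = metric_projection C (dual_duality_map \<psi> + y)} =
              {y \<in> C. y = generalized_projection C (\<psi> + duality_map y)})"
proof -
  note hyps = assms
  have sub: "face C \<psi> \<subseteq> C" for \<psi>
    by (auto simp: face_def)
  have metric: "{y \<in> C. y = metric_projection C (u + y)} = face C (duality_map u)" for u :: 'a
    using eq_metric_projection_iff[OF hyps] sub by blast
  have generalized: "{y \<in> C. y = generalized_projection C (\<psi> + duality_map y)} = face C \<psi>" for \<psi>
    using eq_generalized_projection_iff[OF hyps] sub by blast
  \<comment> \<open>With this, the metric projection part of (b) is that of (a) at
    \<open>u = dual_duality_map \<psi>\<close>.\<close>
  have "duality_map (dual_duality_map \<psi>) = \<psi>" for \<psi> :: "'a \<Rightarrow>\<^sub>L real"
    unfolding dual_duality_map_def by (rule surj_f_inv_f[OF duality_map_surj[OF assms(1,2)]])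
  then show ?thesis
    unfolding metric generalized by simp
qed

end
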